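(* Let $\theta\in[0,1]$ and $a=0$. Then, for all $\ell\ge1$, $$p_{\ell-1}^0(\theta)=(-1)^\ell\phi_\ell(\theta)=(-1)^\ell\sum_{\ell\text{-profile }\mathbf r}\binom{\sum_{i=1}^\ell r_i}{r_1,\ldots,r_\ell}\prod_{i=1}^\ell\left(\frac{-\theta^{i(i-1)/2}}{i!}\right)^{r_i}.$$
   Context: Let $X_1,X_2,\ldots$ be i.i.d. random variables uniformly distributed on $[0,1]$. Set $p_0^0(\theta):=1$ and, for $n\ge1$, $p_n^0(\theta):=\mathbb P(X_2\ge\theta X_1,\ldots,X_{n+1}\ge\theta X_n)$. For an integer $\ell\ge1$, an $\ell$-profile is a vector $\mathbf r=(r_1,\ldots,r_\ell)$ of integers $r_i\ge0$ with $\sum_{i=1}^\ell i\,r_i=\ell$. Define $$\phi_\ell(\theta):=\sum_{\ell\text{-profile }\mathbf r}\binom{\sum_{i=1}^\ell r_i}{r_1,\ldots,r_\ell}\prod_{i=1}^\ell\left[\frac{-\theta^{i(i-1)/2}}{i!}\right]^{r_i},$$ where the sum is over all $\ell$-profiles and $\binom{\sum_i r_i}{r_1,\ldots,r_\ell}=\frac{(\sum_i r_i)!}{\prod_j r_j!}$ is the multinomial coefficient; $0^0=1$. *)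

theory Defs
  imports "HOL-Probability.Probability"
begin

definition iid_uniform01 :: "'a measure \<Rightarrow> (nat \<Rightarrow> 'a \<Rightarrow> real) \<Rightarrow> bool" where
  "iid_uniform01 M X \<longleftrightarrow>
     prob_space.indep_vars M (\<lambda>_. borel) X {1..} \<and>
     (\<forall>i\<ge>1. distr M borel (X i) = uniform_measure lborel {0..1})"

definition persistence :: "'a measure \<Rightarrow> (nat \<Rightarrow> 'a \<Rightarrow> real) \<Rightarrow> nat \<Rightarrow> real \<Rightarrow> real" where
  "persistence M X n \<theta> =
     (if n = 0 then 1
      else measure M {\<omega> \<in> space M. \<forall>i\<in>{1..n}. X (i + 1) \<omega> \<ge> \<theta> * X i \<omega>})"

(* The vector (r_1, ..., r_l) is an extensional function on {1..l}, so that distinct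
   elements of this set are distinct vectors. *)
definition profiles :: "nat \<Rightarrow> (nat \<Rightarrow> nat) set" where
  "profiles l = {r \<in> {1..l} \<rightarrow>\<^sub>E UNIV. (\<Sum>i=1..l. i * r i) = l}"

definition multinomial :: "nat \<Rightarrow> (nat \<Rightarrow> nat) \<Rightarrow> real" where
  "multinomial l r = fact (\<Sum>i=1..l. r i) / (\<Prod>j=1..l. fact (r j))"

(* i * (i - 1) is even, so the exponent i * (i - 1) div 2 is exact. *)
definition phi :: "nat \<Rightarrow> real \<Rightarrow> real" where
  "phi l \<theta> = (\<Sum>r\<in>profiles l. multinomial l r *
     (\<Prod>i=1..l. (- (\<theta> ^ (i * (i - 1) div 2)) / fact i) ^ r i))"

(* The sum defining phi is genuinely a finite sum, not the default value 0. *)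
lemma finite_profiles: "finite (profiles l)"
proof (rule finite_subset)
  show "profiles l \<subseteq> {1..l} \<rightarrow>\<^sub>E {..l}"
  proof
    fix r assume r: "r \<in> profiles l"
    have "r i \<le> l" if i: "i \<in> {1..l}" for i
    proof -
      have "r i \<le> i * r i" using i by simp
      also have "\<dots> \<le> (\<Sum>i=1..l. i * r i)" using i by (intro member_le_sum) auto
      also have "\<dots> = l" using r by (simp add: profiles_def)
      finally show ?thesis .
    qed
    then show "r \<in> {1..l} \<rightarrow>\<^sub>E {..l}" using r by (auto simp: profiles_def PiE_iff)
  qed
qed (simp add: finite_PiE)

end

theory Submission
  imports Defs
begin

text \<open>
  Consider independent uniform \<open>Y\<^sub>1, \<dots>, Y\<^sub>n\<close>, and let \<open>h\<^sub>n(x)\<close> be the probability that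
  \<open>Y\<^sub>1 \<ge> \<theta> x, Y\<^sub>2 \<ge> \<theta> Y\<^sub>1, \<dots>, Y\<^sub>n \<ge> \<theta> Y\<^sub>n\<^sub>-\<^sub>1\<close>. The persistence probability with \<open>l - 1\<close> comparisons is
  \<open>h\<^sub>l(0)\<close>. Conditioning on \<open>Y\<^sub>1\<close> gives \<open>h\<^sub>0 = 1\<close> and \<open>h\<^sub>n\<^sub>+\<^sub>1(x) = \<integral> h\<^sub>n(y) dy\<close> over
  \<open>\<theta> x \<le> y \<le> 1\<close>, where \<open>\<theta> x \<le> 1\<close> because \<open>\<theta> \<le> 1\<close>. Writing the integral as its value over
  \<open>[0, 1]\<close> minus that over \<open>[0, \<theta> x]\<close>, one finds that \<open>h\<^sub>n\<close> is the polynomial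
  \<open>\<Sum>i\<le>n. (-1)\<^sup>i \<theta>\<^bsup>i(i+1)/2\<^esup> x\<^sup>i / i! * h\<^sub>n\<^sub>-\<^sub>i(0)\<close>, and integrating it over \<open>[0, 1]\<close> gives
  \<open>h\<^sub>n\<^sub>+\<^sub>1(0) = \<Sum>i\<le>n. (-1)\<^sup>i \<theta>\<^bsup>i(i+1)/2\<^esup> / (i+1)! * h\<^sub>n\<^sub>-\<^sub>i(0)\<close>.

  On the other side, Pascal's rule for multinomial coefficients shows that
  \<open>\<phi>\<^sub>l = \<Sum>i=1..l. - \<theta>\<^bsup>i(i-1)/2\<^esup> / i! * \<phi>\<^sub>l\<^sub>-\<^sub>i\<close> with \<open>\<phi>\<^sub>0 = 1\<close> (lemmas \<open>profile_weight_pascal\<close> and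
  \<open>phi_rec\<close>). Hence \<open>(-1)\<^sup>l \<phi>\<^sub>l\<close> satisfies the recursion of \<open>h\<^sub>l(0)\<close>. In the formal argument the
  polynomials are therefore defined with \<open>(-1)\<^sup>m \<phi>\<^sub>m\<close> in place of \<open>h\<^sub>m(0)\<close>, and lemma
  \<open>emeasure_chain_event\<close> identifies them with the probabilities.
\<close>

section \<open>A recursion for sums over profiles\<close>


text \<open>
  The vectors \<open>(r\<^sub>1, \<dots>, r\<^sub>L)\<close> of total weight \<open>m\<close>. Here \<open>padded_profiles l l\<close> is the set of
  \<open>l\<close>-profiles. For \<open>m < L\<close> the entries beyond position \<open>m\<close> vanish, so that the elements are the
  \<open>m\<close>-profiles padded with zeros; keeping \<open>L\<close> fixed allows one to lower an entry of a profile
  without changing the index set.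
\<close>
definition padded_profiles :: "nat \<Rightarrow> nat \<Rightarrow> (nat \<Rightarrow> nat) set" where
  "padded_profiles L m = {r \<in> {1..L} \<rightarrow>\<^sub>E UNIV. (\<Sum>i=1..L. i * r i) = m}"

text \<open>
  The summand of \<^const>\<open>phi\<close>, with arbitrary coefficients \<open>a i\<close> in place of
  \<open>- \<theta>\<^bsup>i(i-1)/2\<^esup> / i!\<close>.
\<close>
definition profile_weight :: "(nat \<Rightarrow> real) \<Rightarrow> nat \<Rightarrow> (nat \<Rightarrow> nat) \<Rightarrow> real" where
  "profile_weight a L r = multinomial L r * (\<Prod>i=1..L. a i ^ r i)"

lemma padded_profile_le:
  assumes "r \<in> padded_profiles L m" "i \<in> {1..L}"
  shows "i * r i \<le> m"
proof -
  have "i * r i \<le> (\<Sum>i=1..L. i * r i)" using assms(2) by (intro member_le_sum) auto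
  then show ?thesis using assms(1) by (simp add: padded_profiles_def)
qed

lemma finite_padded_profiles: "finite (padded_profiles L m)"
proof (rule finite_subset)
  show "padded_profiles L m \<subseteq> {1..L} \<rightarrow>\<^sub>E {..m}"
  proof
    fix r assume r: "r \<in> padded_profiles L m"
    have "r i \<le> m" if i: "i \<in> {1..L}" for i
      using padded_profile_le[OF r i] i by (metis atLeastAtMost_iff le_trans mult_le_mono1 mult_1)
    then show "r \<in> {1..L} \<rightarrow>\<^sub>E {..m}" using r by (auto simp: padded_profiles_def PiE_iff)
  qed
qed (simp add: finite_PiE)

lemma padded_profile_eq_0:
  assumes "r \<in> padded_profiles L m" "i \<in> {1..L}" "m < i"
  shows "r i = 0"
proof (rule ccontr)
  assume "r i \<noteq> 0"
  then have "i \<le> i * r i" by simp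
  with padded_profile_le[OF assms(1,2)] assms(3) show False by linarith
qed

text \<open>Padding with zeros is a bijection between profiles that preserves the weight.\<close>
lemma sum_padded_profiles:
  assumes "m \<le> L"
  shows "(\<Sum>r\<in>padded_profiles L m. profile_weight a L r) = (\<Sum>r\<in>profiles m. profile_weight a m r)"
proof (rule sum.reindex_bij_witness[of _ "\<lambda>r. \<lambda>i\<in>{1..L}. if i \<le> m then r i else 0"
        "\<lambda>r. restrict r {1..m}"])
  have split: "{1..L} = {1..m} \<union> {m<..L}" "{1..m} \<inter> {m<..L} = {}" using assms by auto
  fix r assume r: "r \<in> padded_profiles L m"
  have zero: "r i = 0" if "i \<in> {m<..L}" for i
    using padded_profile_eq_0[OF r, of i] that by auto
  show "(\<lambda>i\<in>{1..L}. if i \<le> m then restrict r {1..m} i else 0) = r"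
    using r zero by (auto simp: padded_profiles_def fun_eq_iff PiE_iff extensional_def)
  have "(\<Sum>i=1..L. i * r i) = (\<Sum>i=1..m. i * r i)"
    unfolding split(1) by (subst sum.union_disjoint) (use split(2) zero in auto)
  then show "restrict r {1..m} \<in> profiles m"
    using r by (auto simp: padded_profiles_def profiles_def)
  have 1: "(\<Sum>i=1..L. r i) = (\<Sum>i=1..m. r i)"
    unfolding split(1) by (subst sum.union_disjoint) (use split(2) zero in auto)
  have 2: "(\<Prod>i=1..L. f i (r i)) = (\<Prod>i=1..m. f i (r i))" if "\<And>i. f i 0 = 1"
    for f :: "nat \<Rightarrow> nat \<Rightarrow> real"
    unfolding split(1) by (subst prod.union_disjoint) (use split(2) zero that in auto)
  show "profile_weight a m (restrict r {1..m}) = profile_weight a L r"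
    unfolding profile_weight_def multinomial_def
    using 1 2[of "\<lambda>_ k. fact k"] 2[of "\<lambda>i k. a i ^ k"] by simp
next
  have split: "{1..L} = {1..m} \<union> {m<..L}" "{1..m} \<inter> {m<..L} = {}" using assms by auto
  fix r assume r: "r \<in> profiles m"
  let ?r = "\<lambda>i\<in>{1..L}. if i \<le> m then r i else 0"
  show "restrict ?r {1..m} = r"
    using r assms by (auto simp: profiles_def fun_eq_iff PiE_iff extensional_def)
  have "(\<Sum>i=1..L. i * ?r i) = (\<Sum>i=1..m. i * r i)"
    unfolding split(1) by (subst sum.union_disjoint) (use split(2) in auto)
  then show "?r \<in> padded_profiles L m"
    using r by (auto simp: padded_profiles_def profiles_def)
qed

lemma profile_weight_decr:
  assumes i: "i \<in> {1..L}" and pos: "0 < r i"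
  shows "a i * profile_weight a L (r(i := r i - 1)) =
    real (r i) / real (\<Sum>j=1..L. r j) * profile_weight a L r"
proof -
  define S where "S = {1..L} - {i}"
  have S: "{1..L} = insert i S" "i \<notin> S" "finite S" using i by (auto simp: S_def)
  obtain k where k: "r i = Suc k" using pos by (metis gr0_conv_Suc)
  have upd: "(\<Prod>j\<in>S. f j ((r(i := k)) j)) = (\<Prod>j\<in>S. f j (r j))" for f :: "nat \<Rightarrow> nat \<Rightarrow> real"
    using S(2) by (intro prod.cong) auto
  have upds: "(\<Sum>j\<in>S. (r(i := k)) j) = (\<Sum>j\<in>S. r j)"
    using S(2) by (intro sum.cong) auto
  define P where "P = (\<Prod>j\<in>S. fact (r j) :: real)"
  have P: "P \<noteq> 0" by (simp add: P_def S(3))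
  define N where "N = sum r S"
  have "real (k + N + 1) \<noteq> 0" by simp
  then show ?thesis
    unfolding profile_weight_def multinomial_def S(1)
    using S(2,3) upd[of "\<lambda>_ k. fact k"] upd[of "\<lambda>j k. a j ^ k"] upds P
    by (simp add: k flip: P_def N_def)
qed

text \<open>
  Pascal's rule for multinomial coefficients: the factors \<open>r i / (\<Sum>j. r j)\<close> of the previous lemma
  add up to \<open>1\<close>.
\<close>
lemma profile_weight_pascal:
  assumes r: "r \<in> padded_profiles L m" and m: "0 < m"
  shows "profile_weight a L r =
    (\<Sum>i \<in> {i \<in> {1..L}. 0 < r i}. a i * profile_weight a L (r(i := r i - 1)))"
proof -
  have "(\<Sum>j=1..L. r j) \<noteq> 0"
  proof
    assume "(\<Sum>j=1..L. r j) = 0"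
    then have "(\<Sum>j=1..L. j * r j) = 0" by simp
    with r m show False by (simp add: padded_profiles_def)
  qed
  moreover have "(\<Sum>i \<in> {i \<in> {1..L}. 0 < r i}. r i) = (\<Sum>j=1..L. r j)"
    by (intro sum.mono_neutral_left) auto
  then have "(\<Sum>i \<in> {i \<in> {1..L}. 0 < r i}. real (r i)) = real (\<Sum>j=1..L. r j)"
    by (metis of_nat_sum)
  ultimately have "(\<Sum>i \<in> {i \<in> {1..L}. 0 < r i}.
      real (r i) / real (\<Sum>j=1..L. r j) * profile_weight a L r) = profile_weight a L r"
    by (simp del: of_nat_sum flip: sum_distrib_right sum_divide_distrib)
  moreover have "(\<Sum>i \<in> {i \<in> {1..L}. 0 < r i}. a i * profile_weight a L (r(i := r i - 1))) =
     (\<Sum>i \<in> {i \<in> {1..L}. 0 < r i}.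
      real (r i) / real (\<Sum>j=1..L. r j) * profile_weight a L r)"
    by (intro sum.cong refl profile_weight_decr) auto
  ultimately show ?thesis by simp
qed

text \<open>
  Equivalently, the sums over profiles are the coefficients of the formal power series
  \<open>1 / (1 - (\<Sum>i\<ge>1. a i * z\<^sup>i))\<close>.
\<close>
lemma sum_profile_weight_rec:
  assumes "0 < m"
  shows "(\<Sum>r\<in>profiles m. profile_weight a m r) =
    (\<Sum>i=1..m. a i * (\<Sum>r\<in>profiles (m - i). profile_weight a (m - i) r))"
proof -
  have weighted_sum: "(\<Sum>j=1..m. j * (r(i := x)) j) + i * r i = (\<Sum>j=1..m. j * r j) + i * x"
    if "i \<in> {1..m}" for r :: "nat \<Rightarrow> nat" and i x
  proof -
    have "(\<Sum>j\<in>{1..m} - {i}. j * (r(i := x)) j) = (\<Sum>j\<in>{1..m} - {i}. j * r j)"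
      by (rule sum.cong) auto
    then show ?thesis using that
      by (simp only: sum.remove[of "{1..m}" i, OF _ that] finite_atLeastAtMost fun_upd_same)
  qed
  have "(\<Sum>r\<in>profiles m. profile_weight a m r) = (\<Sum>r\<in>padded_profiles m m. profile_weight a m r)"
    by (simp add: sum_padded_profiles)
  also have "\<dots> = (\<Sum>r\<in>padded_profiles m m.
      \<Sum>i \<in> {i \<in> {1..m}. 0 < r i}. a i * profile_weight a m (r(i := r i - 1)))"
    using assms by (intro sum.cong refl profile_weight_pascal) auto
  also have "\<dots> = (\<Sum>i=1..m. \<Sum>r\<in>{r \<in> padded_profiles m m. 0 < r i}.
      a i * profile_weight a m (r(i := r i - 1)))"
    by (rule sum.swap_restrict) (auto simp: finite_padded_profiles)
  also have "\<dots> = (\<Sum>i=1..m. \<Sum>r\<in>padded_profiles m (m - i). a i * profile_weight a m r)"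
  proof (rule sum.cong[OF refl])
    fix i assume i: "i \<in> {1..m}"
    show "(\<Sum>r\<in>{r \<in> padded_profiles m m. 0 < r i}. a i * profile_weight a m (r(i := r i - 1)))
        = (\<Sum>r\<in>padded_profiles m (m - i). a i * profile_weight a m r)"
    proof (rule sum.reindex_bij_witness[of _ "\<lambda>r. r(i := r i + 1)" "\<lambda>r. r(i := r i - 1)"])
      fix r assume r: "r \<in> {r \<in> padded_profiles m m. 0 < r i}"
      then obtain k where k: "r i = Suc k" by (auto simp: gr0_conv_Suc)
      show "r(i := r i - 1) \<in> padded_profiles m (m - i)"
        using r i weighted_sum[OF i, of r k] by (auto simp: k padded_profiles_def PiE_iff extensional_def)
    next
      fix r assume r: "r \<in> padded_profiles m (m - i)"
      show "r(i := r i + 1) \<in> {r \<in> padded_profiles m m. 0 < r i}"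
        using r i weighted_sum[OF i, of r "Suc (r i)"] by (auto simp: padded_profiles_def PiE_iff extensional_def)
    qed (use i in auto)
  qed
  also have "\<dots> = (\<Sum>i=1..m. a i * (\<Sum>r\<in>profiles (m - i). profile_weight a (m - i) r))"
    by (simp add: sum_padded_profiles flip: sum_distrib_left)
  finally show ?thesis .
qed

lemma phi_0: "phi 0 \<theta> = 1"
proof -
  have "profiles 0 = {\<lambda>_. undefined}"
    unfolding profiles_def by auto
  then show ?thesis
    by (simp add: phi_def multinomial_def)
qed

lemma phi_rec:
  assumes "0 < l"
  shows "phi l \<theta> = (\<Sum>i=1..l. - (\<theta> ^ (i * (i - 1) div 2)) / fact i * phi (l - i) \<theta>)"
  using sum_profile_weight_rec [OF assms, of "\<lambda>i. - (\<theta> ^ (i * (i - 1) div 2)) / fact i"]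
  by (simp only: phi_def profile_weight_def)

section \<open>The chain polynomials\<close>

text \<open>
  For \<open>\<theta>\<close> and \<open>x\<close> in \<open>[0, 1]\<close> this is the probability that
  \<open>Y\<^sub>1 \<ge> \<theta> x, Y\<^sub>2 \<ge> \<theta> Y\<^sub>1, \<dots>, Y\<^sub>n \<ge> \<theta> Y\<^sub>n\<^sub>-\<^sub>1\<close> for independent uniform \<open>Y\<^sub>1, \<dots>, Y\<^sub>n\<close>.
  The factors \<open>(-1)\<^bsup>n-i\<^esup> \<phi>\<^sub>n\<^sub>-\<^sub>i\<close> are the values at \<open>0\<close> of the polynomials of index
  \<open>n - i\<close>.
\<close>
definition chain_poly :: "real \<Rightarrow> nat \<Rightarrow> real \<Rightarrow> real" where
  "chain_poly \<theta> n x = (\<Sum>i\<le>n. (-1) ^ i * \<theta> ^ (i * (i + 1) div 2) * x ^ i / fact i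
     * ((-1) ^ (n - i) * phi (n - i) \<theta>))"

text \<open>The antiderivative of \<^const>\<open>chain_poly\<close> that vanishes at \<open>0\<close>.\<close>
definition chain_poly_int :: "real \<Rightarrow> nat \<Rightarrow> real \<Rightarrow> real" where
  "chain_poly_int \<theta> n x = (\<Sum>i\<le>n. (-1) ^ i * \<theta> ^ (i * (i + 1) div 2) * x ^ Suc i / fact (Suc i)
     * ((-1) ^ (n - i) * phi (n - i) \<theta>))"

lemma chain_poly_0: "chain_poly \<theta> 0 x = 1"
  by (simp add: chain_poly_def phi_0)

lemma chain_poly_at_0: "chain_poly \<theta> n 0 = (-1) ^ n * phi n \<theta>"
  by (simp add: chain_poly_def sum.atMost_shift)

lemma has_real_derivative_chain_poly_int:
  "(chain_poly_int \<theta> n has_real_derivative chain_poly \<theta> n x) (at x within A)"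
proof -
  have "((\<lambda>x. c * x ^ Suc i / fact (Suc i) * d) has_real_derivative
      c * x ^ i / fact i * d) (at x within A)" for c d :: real and i
  proof -
    have "((\<lambda>x. c * x ^ Suc i / fact (Suc i) * d) has_real_derivative
      c * (real (Suc i) * x ^ i) / fact (Suc i) * d) (at x within A)"
      by (intro derivative_eq_intros refl) auto
    also have "c * (real (Suc i) * x ^ i) / fact (Suc i) * d = c * x ^ i / fact i * d"
      by (simp add: divide_simps del: of_nat_Suc)
    finally show ?thesis .
  qed
  then show ?thesis unfolding chain_poly_def [abs_def] chain_poly_int_def [abs_def]
    by (intro DERIV_sum)
qed

lemma continuous_on_chain_poly: "continuous_on A (chain_poly \<theta> n)"
  unfolding chain_poly_def [abs_def] by (intro continuous_intros) auto

text \<open>This is the recursion for \<^const>\<open>phi\<close>, read as the value of an integral over \<open>[0, 1]\<close>.\<close>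
lemma chain_poly_int_1: "chain_poly_int \<theta> n 1 = (-1) ^ Suc n * phi (Suc n) \<theta>"
proof -
  have "phi (Suc n) \<theta> = (\<Sum>i\<le>n. - (\<theta> ^ (Suc i * i div 2)) / fact (Suc i) * phi (n - i) \<theta>)"
    by (subst phi_rec, simp)
      (simp add: sum.atLeast1_atMost_eq lessThan_Suc_atMost del: fact_Suc sum.cl_ivl_Suc)
  moreover have "(-1::real) ^ n = (-1) ^ i * (-1) ^ (n - i)" if "i \<le> n" for i
    using that by (simp flip: power_add)
  ultimately show ?thesis unfolding chain_poly_int_def
    by (auto simp: sum_distrib_left mult_ac sum_negf simp del: fact_Suc intro!: sum.cong)
qed

text \<open>In other words, \<open>chain_poly \<theta> (Suc n) x\<close> is the integral of \<open>chain_poly \<theta> n\<close> from \<open>\<theta> x\<close> to \<open>1\<close>.\<close>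
lemma chain_poly_Suc:
  "chain_poly \<theta> (Suc n) x = chain_poly_int \<theta> n 1 - chain_poly_int \<theta> n (\<theta> * x)"
proof -
  \<comment> \<open>the substitution of \<open>\<theta> x\<close> for \<open>x\<close> in degree \<open>i + 1\<close> takes one triangular number to the next\<close>
  have tri: "Suc i * (Suc i + 1) div 2 = i * (i + 1) div 2 + Suc i" for i
  proof -
    have "Suc i * (Suc i + 1) = i * (i + 1) + 2 * Suc i" by simp
    then show ?thesis by simp
  qed
  have "chain_poly \<theta> (Suc n) x = (-1) ^ Suc n * phi (Suc n) \<theta> +
     (\<Sum>i\<le>n. (-1) ^ Suc i * \<theta> ^ (Suc i * (Suc i + 1) div 2) * x ^ Suc i / fact (Suc i)
     * ((-1) ^ (n - i) * phi (n - i) \<theta>))"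
    unfolding chain_poly_def by (subst sum.atMost_Suc_shift) (simp del: fact_Suc)
  also have "(\<Sum>i\<le>n. (-1) ^ Suc i * \<theta> ^ (Suc i * (Suc i + 1) div 2) * x ^ Suc i / fact (Suc i)
     * ((-1) ^ (n - i) * phi (n - i) \<theta>)) = - chain_poly_int \<theta> n (\<theta> * x)"
    unfolding chain_poly_int_def tri power_add power_mult_distrib sum_negf [symmetric]
    by (intro sum.cong refl) simp
  finally show ?thesis by (simp add: chain_poly_int_1)
qed

lemma chain_poly_nonneg:
  assumes "0 \<le> \<theta>" "\<theta> \<le> 1" "0 \<le> x" "x \<le> 1"
  shows "0 \<le> chain_poly \<theta> n x"
  using assms(3,4)
proof (induction n arbitrary: x)
  case (Suc n)
  have x: "\<theta> * x \<le> 1" "0 \<le> \<theta> * x" using assms(1,2) Suc.prems by (simp_all add: mult_le_one)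
  have "chain_poly_int \<theta> n (\<theta> * x) \<le> chain_poly_int \<theta> n 1"
  proof (rule DERIV_nonneg_imp_nondecreasing [OF x(1)])
    fix y assume "\<theta> * x \<le> y" "y \<le> 1"
    then have "0 \<le> chain_poly \<theta> n y" using x(2) by (intro Suc.IH) simp_all
    then show "\<exists>D. (chain_poly_int \<theta> n has_real_derivative D) (at y) \<and> 0 \<le> D"
      using has_real_derivative_chain_poly_int by blast
  qed
  then show ?case by (simp add: chain_poly_Suc)
qed (simp add: chain_poly_0)

lemma nn_integral_chain_poly:
  assumes "0 \<le> \<theta>" "\<theta> \<le> 1" "0 \<le> x" "x \<le> 1"
  shows "(\<integral>\<^sup>+y. ennreal (chain_poly \<theta> n y) * indicator {\<theta> * x..1} y \<partial>lborel) =
    ennreal (chain_poly \<theta> (Suc n) x)"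
proof -
  have "\<theta> * x \<le> 1" "0 \<le> \<theta> * x" using assms by (simp_all add: mult_le_one)
  then show ?thesis unfolding chain_poly_Suc
    by (intro nn_integral_FTC_Icc has_real_derivative_chain_poly_int
        borel_measurable_continuous_onI continuous_on_chain_poly chain_poly_nonneg assms) auto
qed

section \<open>Chains of independent uniform variables\<close>

abbreviation uniform01 :: "real measure" where
  "uniform01 \<equiv> uniform_measure lborel {0..1}"

lemma prob_space_uniform01: "prob_space uniform01"
  by (intro prob_space_uniform_measure) auto

text \<open>
  The event that the \<open>n\<close> consecutive values \<open>f k, \<dots>, f (k + n - 1)\<close> are each at least \<open>\<theta>\<close> times
  their predecessor, the predecessor of \<open>f k\<close> being \<open>x\<close>. It is always true for \<open>n = 0\<close>. The
  starting index \<open>k\<close> is arbitrary because removing the first value shifts it by one.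
\<close>
definition chain_event :: "real \<Rightarrow> nat \<Rightarrow> nat \<Rightarrow> real \<Rightarrow> (nat \<Rightarrow> real) \<Rightarrow> bool" where
  "chain_event \<theta> k n x f \<longleftrightarrow> (0 < n \<longrightarrow> \<theta> * x \<le> f k) \<and>
     (\<forall>i\<in>{k..<k + n - 1}. \<theta> * f i \<le> f (i + 1))"

lemma chain_event_0: "chain_event \<theta> k 0 x f"
  by (auto simp: chain_event_def)

lemma chain_event_Suc:
  "chain_event \<theta> k (Suc n) x f \<longleftrightarrow> \<theta> * x \<le> f k \<and> chain_event \<theta> (Suc k) n (f k) f"
proof (cases n)
  case (Suc m)
  have "{k..<k + Suc n - 1} = insert k {Suc k..<Suc k + n - 1}" using Suc by auto
  then show ?thesis by (auto simp: chain_event_def Suc)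
qed (auto simp: chain_event_def)

lemma chain_event_upd: 
  assumes "j < k"
  shows "chain_event \<theta> k n x (f(j := y)) \<longleftrightarrow> chain_event \<theta> k n x f"
  using assms by (auto simp: chain_event_def)

lemma measurable_chain_event:
  assumes "\<And>i. i \<in> {k..<k + n} \<Longrightarrow> sets (N i) = sets borel"
  shows "Measurable.pred (PiM {k..<k + n} N) (chain_event \<theta> k n x)"
proof -
  have comp: "(\<lambda>f. f i) \<in> borel_measurable (PiM {k..<k + n} N)" if "i \<in> {k..<k + n}" for i
    using measurable_component_singleton[OF that, of N] assms[OF that]
    by (simp cong: measurable_cong_sets)
  have le: "Measurable.pred (PiM {k..<k + n} N) (\<lambda>f. c \<le> f i)" if "i \<in> {k..<k + n}" for i c
  proof -
    note [measurable] = comp[OF that]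
    show ?thesis by measurable
  qed
  have mult_le: "Measurable.pred (PiM {k..<k + n} N) (\<lambda>f. \<theta> * f i \<le> f j)"
    if "i \<in> {k..<k + n}" "j \<in> {k..<k + n}" for i j
  proof -
    show ?thesis unfolding pred_def
      by (intro borel_measurable_le borel_measurable_times borel_measurable_const comp that)
  qed
  show ?thesis unfolding chain_event_def [abs_def]
    by (intro pred_intros_logic pred_intros_finite pred_intros_imp' le mult_le) auto
qed

text \<open>
  By induction on the length of the chain: by Fubini, the first value \<open>y\<close> is integrated last, and
  \<open>y\<close> takes the role of \<open>x\<close> for the rest of the chain.
\<close>
lemma emeasure_chain_event:
  assumes \<theta>: "0 \<le> \<theta>" "\<theta> \<le> 1" and x: "0 \<le> x" "x \<le> 1"
  shows "emeasure (PiM {k..<k + n} (\<lambda>_. uniform01))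
    {f \<in> space (PiM {k..<k + n} (\<lambda>_. uniform01)). chain_event \<theta> k n x f} =
      ennreal (chain_poly \<theta> n x)"
  using x
proof (induction n arbitrary: k x)
  case 0
  interpret product_prob_space "\<lambda>_::nat. uniform01" "{}"
    by (simp add: product_prob_spaceI prob_space_uniform01)
  show ?case using emeasure_space_1 by (simp add: chain_event_0 chain_poly_0)
next
  case (Suc n)
  interpret product_prob_space "\<lambda>_::nat. uniform01" UNIV
    by (simp add: product_prob_spaceI prob_space_uniform01)
  let ?P = "PiM {Suc k..<Suc k + n} (\<lambda>_. uniform01)"
  let ?Q = "PiM {k..<k + Suc n} (\<lambda>_. uniform01)"
  have ins: "{k..<k + Suc n} = insert k {Suc k..<Suc k + n}" by auto
  have meas: "Measurable.pred (PiM {j..<j + m} (\<lambda>_. uniform01)) (chain_event \<theta> j m y)" for j m y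
    by (rule measurable_chain_event) simp
  have setsQ [measurable]: "{f \<in> space ?Q. chain_event \<theta> k (Suc n) x f} \<in> sets ?Q"
    using meas[of k "Suc n" x] unfolding pred_def .
  have setsP: "{f \<in> space ?P. chain_event \<theta> (Suc k) n y f} \<in> sets ?P" for y
    using meas[of "Suc k" n y] unfolding pred_def .
  have "emeasure ?Q {f \<in> space ?Q. chain_event \<theta> k (Suc n) x f} =
    (\<integral>\<^sup>+f. indicator {f \<in> space ?Q. chain_event \<theta> k (Suc n) x f} f \<partial>?Q)"
    by (rule nn_integral_indicator [symmetric]) (rule setsQ)
  also have "\<dots> = (\<integral>\<^sup>+y. \<integral>\<^sup>+f. indicator {f \<in> space ?Q. chain_event \<theta> k (Suc n) x f} (f(k := y))
      \<partial>?P \<partial>uniform01)"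
    unfolding ins
    by (rule product_nn_integral_insert_rev)
      (use setsQ[unfolded ins] in \<open>simp_all add: borel_measurable_indicator\<close>)
  also have "\<dots> = (\<integral>\<^sup>+y. \<integral>\<^sup>+f. indicator {\<theta> * x..} y *
      indicator {f \<in> space ?P. chain_event \<theta> (Suc k) n y f} f \<partial>?P \<partial>uniform01)"
  proof (intro nn_integral_cong)
    fix y f assume f: "f \<in> space ?P"
    then have "f(k := y) \<in> space ?Q"
      unfolding space_PiM ins by (auto simp: PiE_iff extensional_def)
    moreover have "chain_event \<theta> k (Suc n) x (f(k := y)) \<longleftrightarrow>
        \<theta> * x \<le> y \<and> chain_event \<theta> (Suc k) n y f"
      by (simp add: chain_event_Suc chain_event_upd)
    ultimately show "indicator {f \<in> space ?Q. chain_event \<theta> k (Suc n) x f} (f(k := y)) =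
        (indicator {\<theta> * x..} y *
          indicator {f \<in> space ?P. chain_event \<theta> (Suc k) n y f} f :: ennreal)"
      using f by (simp add: indicator_def)
  qed
  also have "\<dots> = (\<integral>\<^sup>+y. indicator {\<theta> * x..} y *
      emeasure ?P {f \<in> space ?P. chain_event \<theta> (Suc k) n y f} \<partial>uniform01)"
    using setsP by (simp add: nn_integral_cmult)
  also have "\<dots> = (\<integral>\<^sup>+y. indicator {\<theta> * x..} y * ennreal (chain_poly \<theta> n y) \<partial>uniform01)"
  proof (intro nn_integral_cong_AE AE_uniform_measureI AE_I2 impI)
    fix y :: real assume "y \<in> {0..1}"
    then show "indicator {\<theta> * x..} y *
        emeasure ?P {f \<in> space ?P. chain_event \<theta> (Suc k) n y f} =
        indicator {\<theta> * x..} y * ennreal (chain_poly \<theta> n y)"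
      using Suc.IH[of y "Suc k"] by simp
  qed simp
  also have "\<dots> = (\<integral>\<^sup>+y. indicator {\<theta> * x..} y * ennreal (chain_poly \<theta> n y) * indicator {0..1} y \<partial>lborel)"
  proof -
    have [measurable]: "chain_poly \<theta> n \<in> borel_measurable borel"
      by (intro borel_measurable_continuous_onI continuous_on_chain_poly)
    show ?thesis by (subst nn_integral_uniform_measure) (simp_all add: divide_ennreal_def)
  qed
  also have "\<dots> = (\<integral>\<^sup>+y. ennreal (chain_poly \<theta> n y) * indicator {\<theta> * x..1} y \<partial>lborel)"
  proof (intro nn_integral_cong)
    fix y :: real
    have "0 \<le> \<theta> * x" using Suc.prems \<theta> by simp
    then show "indicator {\<theta> * x..} y * ennreal (chain_poly \<theta> n y) * indicator {0..1} y =
        ennreal (chain_poly \<theta> n y) * indicator {\<theta> * x..1} y"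
      by (auto simp: indicator_def)
  qed
  also have "\<dots> = ennreal (chain_poly \<theta> (Suc n) x)"
    using Suc.prems \<theta> by (intro nn_integral_chain_poly)
  finally show ?case .
qed

lemma persistence_eq_chain_poly:
  fixes M :: "'a measure" and X :: "nat \<Rightarrow> 'a \<Rightarrow> real"
  assumes "prob_space M" and iid: "iid_uniform01 M X" and \<theta>: "0 \<le> \<theta>" "\<theta> \<le> 1"
  shows "persistence M X n \<theta> = chain_poly \<theta> (Suc n) 0"
proof -
  interpret prob_space M by fact
  let ?I = "{1..<1 + Suc n}"
  have rv: "X i \<in> borel_measurable M" if "1 \<le> i" for i
    using iid that unfolding iid_uniform01_def indep_vars_def by auto
  have dX: "distr M borel (X i) = uniform01" if "1 \<le> i" for i
    using iid that unfolding iid_uniform01_def by auto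
  have indep: "indep_vars (\<lambda>_. borel) X ?I"
    using iid unfolding iid_uniform01_def by (auto intro: indep_vars_subset)
  have joint: "distr M (PiM ?I (\<lambda>_. borel)) (\<lambda>\<omega>. \<lambda>i\<in>?I. X i \<omega>) = PiM ?I (\<lambda>_. uniform01)"
  proof -
    have "distr M (PiM ?I (\<lambda>_. borel)) (\<lambda>\<omega>. \<lambda>i\<in>?I. X i \<omega>) = PiM ?I (\<lambda>i. distr M borel (X i))"
      using indep rv by (subst indep_vars_iff_distr_eq_PiM' [symmetric]) auto
    also have "\<dots> = PiM ?I (\<lambda>_. uniform01)"
      by (intro PiM_cong refl dX) auto
    finally show ?thesis .
  qed
  \<comment> \<open>with \<open>x = 0\<close> the chain event also asks for \<open>X 1\<close> to be nonnegative, which holds almost surely\<close>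
  have "AE y in distr M borel (X 1). 0 \<le> y"
    unfolding dX[OF order_refl] by (intro AE_uniform_measureI) auto
  then have nonneg: "AE \<omega> in M. 0 \<le> X 1 \<omega>"
    by (subst (asm) AE_distr_iff) (auto intro: rv)
  let ?E = "{f \<in> space (PiM ?I (\<lambda>_. borel)). chain_event \<theta> 1 (Suc n) 0 f}"
  have E [measurable]: "?E \<in> sets (PiM ?I (\<lambda>_. borel))"
    using measurable_chain_event[of 1 "Suc n" "\<lambda>_. borel" \<theta> 0] by measurable
  have Xm: "(\<lambda>\<omega>. \<lambda>i\<in>?I. X i \<omega>) \<in> measurable M (PiM ?I (\<lambda>_. borel))"
    by (intro measurable_restrict rv) auto
  \<comment> \<open>for \<open>n = 0\<close> the event is the whole space, in agreement with the value \<open>1\<close>\<close>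
  have "persistence M X n \<theta> = measure M {\<omega> \<in> space M. \<forall>i\<in>{1..n}. X (i + 1) \<omega> \<ge> \<theta> * X i \<omega>}"
    by (auto simp: persistence_def prob_space)
  also have "\<dots> = measure M ((\<lambda>\<omega>. \<lambda>i\<in>?I. X i \<omega>) -` ?E \<inter> space M)"
  proof (rule measure_eq_AE)
    show "AE \<omega> in M. (\<omega> \<in> {\<omega> \<in> space M. \<forall>i\<in>{1..n}. X (i + 1) \<omega> \<ge> \<theta> * X i \<omega>}) =
      (\<omega> \<in> (\<lambda>\<omega>. \<lambda>i\<in>?I. X i \<omega>) -` ?E \<inter> space M)"
      using nonneg by eventually_elim (auto simp: chain_event_def space_PiM)
    have [measurable]: "X i \<in> borel_measurable M" if "i \<in> {1..n}" for i using rv that by auto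
    have [measurable]: "X (i + 1) \<in> borel_measurable M" for i using rv by auto
    show "{\<omega> \<in> space M. \<forall>i\<in>{1..n}. X (i + 1) \<omega> \<ge> \<theta> * X i \<omega>} \<in> sets M"
      by measurable
    show "(\<lambda>\<omega>. \<lambda>i\<in>?I. X i \<omega>) -` ?E \<inter> space M \<in> sets M"
      using Xm E by (rule measurable_sets)
  qed
  also have "\<dots> = measure (distr M (PiM ?I (\<lambda>_. borel)) (\<lambda>\<omega>. \<lambda>i\<in>?I. X i \<omega>)) ?E"
    using Xm E by (rule measure_distr [symmetric])
  also have "\<dots> = measure (PiM ?I (\<lambda>_. uniform01))
      {f \<in> space (PiM ?I (\<lambda>_. uniform01)). chain_event \<theta> 1 (Suc n) 0 f}"
    unfolding joint by (simp add: space_PiM)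
  also have "\<dots> = chain_poly \<theta> (Suc n) 0"
    using emeasure_chain_event[OF \<theta>, of 0 1 "Suc n"] chain_poly_nonneg[OF \<theta>, of 0 "Suc n"]
    by (simp add: measure_def)
  finally show ?thesis .
qed


theorem corollary5:
  fixes M :: "'a measure" and X :: "nat \<Rightarrow> 'a \<Rightarrow> real" and \<theta> :: real and l :: nat
  assumes "prob_space M"
    and "iid_uniform01 M X"
    and "0 \<le> \<theta>" and "\<theta> \<le> 1"
    and "1 \<le> l"
  shows "persistence M X (l - 1) \<theta> = (-1) ^ l * phi l \<theta> \<and>
         (-1) ^ l * phi l \<theta> =
           (-1) ^ l * (\<Sum>r\<in>profiles l. multinomial l r *
             (\<Prod>i=1..l. (- (\<theta> ^ (i * (i - 1) div 2)) / fact i) ^ r i))"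
proof
  show "persistence M X (l - 1) \<theta> = (-1) ^ l * phi l \<theta>"
    using persistence_eq_chain_poly[OF assms(1-4), of "l - 1"] assms(5)
    by (simp add: chain_poly_at_0)
qed (simp only: phi_def)

end
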